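(* Fix integers $k \geq 1$, $j \geq 1$, $s \geq 0$, and a finite rooted ordered tree $\mathcal T$ of height $p \geq 2$. Let $\mathcal K$ be the infinite labeled tree built from $\mathcal T$ and $k,j,s$ as described in the context, let $R(n)$ be its leaf label counting function, $N(i)$ the largest label in the $i$-th block $\mathcal K_i$, and $\nu = \alpha - k(\beta - s + j)$, where $\alpha$ (resp. $\beta$) is the number of leaf labels (resp. penultimate labels) lying in $\mathcal K_1,\dots,\mathcal K_p$. Then for all $n > N(p+1)$, \[R(n) = \sum_{i=1}^k R\bigl(n-s-(i-1)j-R(n-ij)\bigr) + \nu .\] Equivalently, if a function $L$ satisfies $L(n) = \sum_{i=1}^k L(n-s-(i-1)j-L(n-ij)) + \nu$ for all $n > N(p+1)$ and $L(n) = R(n)$ for $1 \leq n \leq N(p+1)$, then $L(n) = R(n)$ for all $n \geq 1$.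
   Context: Construction of $\mathcal K$. The children of each node of $\mathcal T$ are linearly ordered; the height of $\mathcal T$ is the length of a longest path from the root to a node. Build finite ordered rooted trees $\mathcal K_1, \mathcal K_2, \dots$ as follows: $\mathcal K_p$ is a copy of $\mathcal T$; for $2 \leq i < p$, $\mathcal K_i$ is a copy of $\mathcal K_{i+1}$ with all of its leaves deleted; $\mathcal K_1$ is a copy of $\mathcal K_2$ with all its leaves deleted and with one extra node attached as the first child of its root; for $i > p$, $\mathcal K_i$ is a copy of $\mathcal K_{i-1}$ in which exactly $k$ new children are attached to each leaf. The root of $\mathcal K_i$ is called the $i$-th supernode; all other nodes are regular nodes. The infinite tree $\mathcal K$ consists of all the $\mathcal K_i$ together with, for each $i \geq 1$, an edge from the $i$-th supernode to the $(i+1)$-st supernode (so the $i$-th supernode is an additional child of the $(i+1)$-st). Traversal order: first the nodes of $\mathcal K_1$, in the order: the extra child, then the first supernode, then the remaining children of the first supernode in their order; then, for $i = 2,3,\dots$ successively, the nodes of $\mathcal K_i$ in the usual pre-order of $\mathcal K_i$ (node first, then the subtrees of its children in order). Labeling: each supernode receives $s$ labels and each regular node receives $j$ labels; the labels are the consecutive positive integers $1,2,3,\dots$ assigned following the traversal order (consecutively within a node). A leaf of $\mathcal K$ is a node with no children in $\mathcal K$; a label is a leaf label if it lies in a leaf of $\mathcal K$. A penultimate node is a non-leaf node of $\mathcal K$ all of whose children in $\mathcal K$ are leaves of $\mathcal K$; its labels are penultimate labels. $R(n)$ is the number of leaf labels that are $\leq n$. $N(i)$ denotes the largest label occurring in $\mathcal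 K_i$. *)

theory Defs
  imports Main
begin

datatype otree = Node (children: "otree list")

fun height :: "otree \<Rightarrow> nat" where
  "height (Node ts) = (if ts = [] then 0 else Suc (Max (height ` set ts)))"

text \<open>Only applied to trees whose root is not a leaf, so the root itself is never deleted.\<close>

fun delete_leaves :: "otree \<Rightarrow> otree" where
  "delete_leaves (Node ts) = Node (map delete_leaves (filter (\<lambda>t. children t \<noteq> []) ts))"

fun extend_leaves :: "nat \<Rightarrow> otree \<Rightarrow> otree" where
  "extend_leaves k (Node ts) =
     (if ts = [] then Node (replicate k (Node [])) else Node (map (extend_leaves k) ts))"

definition add_first_child :: "otree \<Rightarrow> otree" where
  "add_first_child t = Node (Node [] # children t)"

text \<open>
  The tree \<open>\<K>\<^sub>i\<close> for \<open>i \<ge> 1\<close>, with \<open>p = height T\<close>, in iterated form; the lemmas below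
  state the step-by-step construction.
\<close>

definition block :: "nat \<Rightarrow> otree \<Rightarrow> nat \<Rightarrow> otree" where
  "block k T i =
     (if i = 1 then add_first_child ((delete_leaves ^^ (height T - 1)) T)
      else if i < height T then (delete_leaves ^^ (height T - i)) T
      else (extend_leaves k ^^ (i - height T)) T)"

lemma block_height: "2 \<le> height T \<Longrightarrow> block k T (height T) = T"
  by (simp add: block_def)

lemma block_below:
  assumes "2 \<le> i" "i < height T"
  shows "block k T i = delete_leaves (block k T (Suc i))"
proof -
  have "height T - i = Suc (height T - Suc i)" using assms by simp
  then show ?thesis using assms by (auto simp: block_def)
qed

lemma block_first:
  assumes "2 \<le> height T"
  shows "block k T 1 = add_first_child (delete_leaves (block k T 2))"
proof -
  have "height T - 1 = Suc (height T - 2)" using assms by simp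
  then show ?thesis using assms by (auto simp: block_def)
qed

lemma block_above:
  assumes "2 \<le> height T" "height T < i"
  shows "block k T i = extend_leaves k (block k T (i - 1))"
proof -
  have "i - height T = Suc (i - 1 - height T)" using assms by simp
  then show ?thesis using assms by (auto simp: block_def)
qed

text \<open>
  A node of an ordered tree is addressed by the list of (zero-based) child indices on the path
  from the root to it; \<open>preorder\<close> lists all addresses in pre-order.
\<close>

fun preorder :: "otree \<Rightarrow> nat list list"
  and preorder_forest :: "nat \<Rightarrow> otree list \<Rightarrow> nat list list" where
  "preorder (Node ts) = [] # preorder_forest 0 ts"
| "preorder_forest c [] = []"
| "preorder_forest c (t # ts) = map ((#) c) (preorder t) @ preorder_forest (Suc c) ts"

text \<open>
  The node \<open>(i, x)\<close> of \<open>\<K>\<close> is the node of \<open>\<K>\<^sub>i\<close> with address \<open>x\<close>. The \<open>i\<close>-th supernode is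
  \<open>(i, [])\<close>, and the extra child in \<open>\<K>\<^sub>1\<close> is \<open>(1, [0])\<close>.
\<close>

type_synonym node = "nat \<times> nat list"

definition nodes :: "nat \<Rightarrow> otree \<Rightarrow> node set" where
  "nodes k T = {(i, x). 1 \<le> i \<and> x \<in> set (preorder (block k T i))}"

definition is_supernode :: "node \<Rightarrow> bool" where
  "is_supernode v \<longleftrightarrow> snd v = []"

definition child_of :: "nat \<Rightarrow> otree \<Rightarrow> node \<Rightarrow> node \<Rightarrow> bool" where
  "child_of k T u v \<longleftrightarrow> u \<in> nodes k T \<and> v \<in> nodes k T \<and>
     (fst u = fst v \<and> (\<exists>c. snd u = snd v @ [c]) \<or>
      is_supernode u \<and> is_supernode v \<and> fst v = Suc (fst u))"

definition is_leaf :: "nat \<Rightarrow> otree \<Rightarrow> node \<Rightarrow> bool" where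
  "is_leaf k T v \<longleftrightarrow> v \<in> nodes k T \<and> \<not> (\<exists>u. child_of k T u v)"

definition is_penultimate :: "nat \<Rightarrow> otree \<Rightarrow> node \<Rightarrow> bool" where
  "is_penultimate k T v \<longleftrightarrow>
     v \<in> nodes k T \<and> \<not> is_leaf k T v \<and> (\<forall>u. child_of k T u v \<longrightarrow> is_leaf k T u)"

definition block_traversal :: "nat \<Rightarrow> otree \<Rightarrow> nat \<Rightarrow> node list" where
  "block_traversal k T i =
     map (Pair i)
       (if i = 1 then [0] # filter (\<lambda>x. x \<noteq> [0]) (preorder (block k T 1))
        else preorder (block k T i))"

definition traversal_upto :: "nat \<Rightarrow> otree \<Rightarrow> nat \<Rightarrow> node list" where
  "traversal_upto k T i = concat (map (block_traversal k T) [1..<Suc i])"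

definition num_labels :: "nat \<Rightarrow> nat \<Rightarrow> node \<Rightarrow> nat" where
  "num_labels j s v = (if is_supernode v then s else j)"

text \<open>The number of labels used up before the traversal reaches \<open>v\<close>.\<close>

definition label_offset :: "nat \<Rightarrow> nat \<Rightarrow> nat \<Rightarrow> otree \<Rightarrow> node \<Rightarrow> nat" where
  "label_offset k j s T v =
     sum_list (map (num_labels j s) (takeWhile (\<lambda>u. u \<noteq> v) (traversal_upto k T (fst v))))"

definition labels :: "nat \<Rightarrow> nat \<Rightarrow> nat \<Rightarrow> otree \<Rightarrow> node \<Rightarrow> nat set" where
  "labels k j s T v =
     {label_offset k j s T v + 1 .. label_offset k j s T v + num_labels j s v}"

definition block_labels :: "nat \<Rightarrow> nat \<Rightarrow> nat \<Rightarrow> otree \<Rightarrow> nat \<Rightarrow> nat set" where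
  "block_labels k j s T i = (\<Union>v \<in> {v \<in> nodes k T. fst v = i}. labels k j s T v)"

definition leaf_labels :: "nat \<Rightarrow> nat \<Rightarrow> nat \<Rightarrow> otree \<Rightarrow> nat set" where
  "leaf_labels k j s T = (\<Union>v \<in> {v. is_leaf k T v}. labels k j s T v)"

definition penultimate_labels :: "nat \<Rightarrow> nat \<Rightarrow> nat \<Rightarrow> otree \<Rightarrow> nat set" where
  "penultimate_labels k j s T = (\<Union>v \<in> {v. is_penultimate k T v}. labels k j s T v)"

definition leaf_count :: "nat \<Rightarrow> nat \<Rightarrow> nat \<Rightarrow> otree \<Rightarrow> int \<Rightarrow> int" where
  "leaf_count k j s T n = int (card {l \<in> leaf_labels k j s T. int l \<le> n})"

definition max_label :: "nat \<Rightarrow> nat \<Rightarrow> nat \<Rightarrow> otree \<Rightarrow> nat \<Rightarrow> nat" where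
  "max_label k j s T i = Max (block_labels k j s T i)"

definition alpha :: "nat \<Rightarrow> nat \<Rightarrow> nat \<Rightarrow> otree \<Rightarrow> nat" where
  "alpha k j s T =
     card (leaf_labels k j s T \<inter> (\<Union>i \<in> {1..height T}. block_labels k j s T i))"

definition beta :: "nat \<Rightarrow> nat \<Rightarrow> nat \<Rightarrow> otree \<Rightarrow> nat" where
  "beta k j s T =
     card (penultimate_labels k j s T \<inter> (\<Union>i \<in> {1..height T}. block_labels k j s T i))"

definition nu :: "nat \<Rightarrow> nat \<Rightarrow> nat \<Rightarrow> otree \<Rightarrow> int" where
  "nu k j s T = int (alpha k j s T) - int k * (int (beta k j s T) - int s + int j)"

end

theory Submission
  imports Defs
begin

text \<open>
  Spell out \<open>\<K>\<close> as an infinite word with one letter per label, recording whether the label lies in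
  a leaf, in a penultimate node or in any other node.  Deleting all leaves from \<open>\<K>\<close> gives \<open>\<K>\<close> back,
  with the penultimate nodes as the new leaves and the first supernode in the role of the extra
  child, which carries \<open>j\<close> labels instead of \<open>s\<close>; so if \<open>P\<close> counts penultimate labels, then \<open>R (m - R m + j - s) = P m + j - s\<close> as soon as
  \<open>m\<close> is past the first supernode.  With \<open>m = n - ij\<close> the left-hand side is the \<open>i\<close>-th summand of the
  recurrence.  Beyond block \<open>p\<close> every penultimate node is directly followed by its \<open>k\<close> leaves, the
  \<open>i\<close>-th of which carries its parent's labels shifted by \<open>ij\<close>; hence
  \<open>R n - \<alpha> = (\<Sum>i = 1..k. (P (n - ij) - \<beta>))\<close>.
\<close>

section \<open>Kinds of nodes in a finite ordered tree\<close>

datatype kind = Leaf | Penult | Inner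

text \<open>Edges between supernodes are ignored here. This does no harm in \<K>: every supernode
  except the first has height at least 2 in its own block, so it is \<open>Inner\<close> with or
  without them.\<close>

definition kind_of :: "otree \<Rightarrow> kind" where
  "kind_of t = (if children t = [] then Leaf
     else if \<forall>u \<in> set (children t). children u = [] then Penult else Inner)"

fun kinds :: "otree \<Rightarrow> kind list" where
  "kinds (Node ts) = kind_of (Node ts) # concat (map kinds ts)"

fun subtree :: "otree \<Rightarrow> nat list \<Rightarrow> otree" where
  "subtree t [] = t"
| "subtree t (c # x) = subtree (children t ! c) x"

lemma subtree_snoc: "subtree t (x @ [c]) = children (subtree t x) ! c"
  by (induction x arbitrary: t) auto

lemma set_preorder_forest:
  "set (preorder_forest c ts) = {(c + d) # x | d x. d < length ts \<and> x \<in> set (preorder (ts ! d))}"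
proof (induction ts arbitrary: c)
  case (Cons t ts)
  have "x \<in> set (preorder_forest c (t # ts)) \<longleftrightarrow>
      x \<in> {(c + d) # x | d x. d < length (t # ts) \<and> x \<in> set (preorder ((t # ts) ! d))}" for x
    unfolding preorder_forest.simps(2) set_append Cons.IH
    by (auto simp: less_Suc_eq_0_disj)
  then show ?case by blast
qed simp

lemma Nil_in_preorder: "[] \<in> set (preorder t)"
  by (cases t) simp

lemma Cons_in_preorder:
  "c # x \<in> set (preorder t) \<longleftrightarrow> c < length (children t) \<and> x \<in> set (preorder (children t ! c))"
  by (cases t) (simp add: set_preorder_forest)

lemma snoc_in_preorder:
  "x @ [c] \<in> set (preorder t) \<longleftrightarrow> x \<in> set (preorder t) \<and> c < length (children (subtree t x))"
  by (induction x arbitrary: t) (auto simp: Cons_in_preorder Nil_in_preorder)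

lemma distinct_preorder: "distinct (preorder t)"
  and distinct_preorder_forest: "distinct (preorder_forest c ts)"
  by (induction t and c ts rule: preorder_preorder_forest.induct)
    (auto simp: set_preorder_forest distinct_map)

text \<open>The recursion on forests moves to a suffix \<open>ts\<close> of a child list, while
  addresses keep indexing the full list \<open>us\<close>; \<open>drop c us = ts\<close> keeps the
  two in step.\<close>

lemma map_kind_preorder: "map (\<lambda>x. kind_of (subtree t x)) (preorder t) = kinds t"
  and map_kind_preorder_forest:
    "drop c us = ts \<Longrightarrow>
      map (\<lambda>x. kind_of (subtree (Node us) x)) (preorder_forest c ts) = concat (map kinds ts)"
proof (induction t and c ts arbitrary: and us rule: preorder_preorder_forest.induct)
  case (3 c t ts)
  have "us ! c = t" "drop (Suc c) us = ts"
    using 3(3) by (metis hd_drop_conv_nth list.discI drop_all linorder_not_le list.sel(1))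
      (metis 3(3) drop_Suc list.sel(3) tl_drop)
  then show ?case using 3 by (simp add: comp_def)
qed auto

text \<open>A surviving node becomes a leaf exactly when all its children were leaves. Only the
  Boolean "is a leaf" is compared, because an \<open>Inner\<close> node may turn into either
  \<open>Penult\<close> or \<open>Inner\<close>, which its old kind does not decide.\<close>

lemma kinds_delete_leaves:
  "children t \<noteq> [] \<Longrightarrow>
    map (\<lambda>a. a = Leaf) (kinds (delete_leaves t)) = map (\<lambda>a. a = Penult) (filter (\<lambda>a. a \<noteq> Leaf) (kinds t))"
proof (induction t)
  case (Node ts)
  have forest: "\<forall>u \<in> set us. children u \<noteq> [] \<longrightarrow>
        map (\<lambda>a. a = Leaf) (kinds (delete_leaves u)) = map (\<lambda>a. a = Penult) (filter (\<lambda>a. a \<noteq> Leaf) (kinds u))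
     \<Longrightarrow> map (\<lambda>a. a = Leaf) (concat (map kinds (map delete_leaves (filter (\<lambda>t. children t \<noteq> []) us))))
       = map (\<lambda>a. a = Penult) (filter (\<lambda>a. a \<noteq> Leaf) (concat (map kinds us)))" for us
  proof (induction us)
    case (Cons u us)
    show ?case
    proof (cases "children u = []")
      case True
      then have "kinds u = [Leaf]" by (cases u) (simp add: kind_of_def)
      then show ?thesis using Cons True by simp
    next
      case False
      then show ?thesis using Cons by simp
    qed
  qed simp
  have "kind_of (Node ts) \<noteq> Leaf" using Node.prems by (simp add: kind_of_def)
  moreover have "kind_of (delete_leaves (Node ts)) = Leaf \<longleftrightarrow> kind_of (Node ts) = Penult"
    using Node.prems by (auto simp: kind_of_def filter_empty_conv)
  ultimately show ?case using forest[of ts] Node.IH by simp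
qed

section \<open>Heights and the shape of the blocks\<close>

lemma height_eq: "height t = (if children t = [] then 0 else Suc (Max (height ` set (children t))))"
  by (cases t) simp

lemma height_eq_0_iff: "height t = 0 \<longleftrightarrow> children t = []"
  by (cases t) simp

text \<open>Leaves have height 0, so dropping them leaves the maximum over the children unchanged if
  some child is not a leaf; the predecessor map is monotone and hence commutes with
  \<open>Max\<close>.\<close>

lemma height_delete_leaves: "height (delete_leaves t) = height t - 1"
proof (induction t)
  case (Node ts)
  let ?us = "filter (\<lambda>t. children t \<noteq> []) ts"
  show ?case
  proof (cases "?us = []")
    case True
    then have "\<forall>u \<in> set ts. height u = 0" by (auto simp: filter_empty_conv height_eq_0_iff)
    then have "ts \<noteq> [] \<Longrightarrow> height ` set ts = {0}" by (cases ts) auto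
    then show ?thesis using True by simp
  next
    case False
    have *: "height ` set (map delete_leaves ?us) = (\<lambda>h. h - 1) ` height ` set ?us"
      using Node.IH by (force simp: image_iff)
    have M: "mono (\<lambda>h::nat. h - 1)" by (auto intro: monoI)
    have "Max (height ` set (map delete_leaves ?us)) = Max (height ` set ?us) - 1"
      unfolding * using False by (subst mono_Max_commute[OF M, symmetric]) (auto simp: filter_empty_conv)
    moreover have "Max (height ` set ts) = Max (height ` set ?us)"
    proof (rule antisym)
      have "height u \<le> Max (height ` set ?us)" if "u \<in> set ts" for u
        using that by (cases "children u = []") (auto simp: height_eq_0_iff[symmetric])
      then show "Max (height ` set ts) \<le> Max (height ` set ?us)"
        using False by (subst Max_le_iff) (auto simp: filter_empty_conv)
      show "Max (height ` set ?us) \<le> Max (height ` set ts)"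
        using False by (intro Max_mono) (auto simp: filter_empty_conv)
    qed
    \<comment> \<open>Positivity of this maximum \<open>M\<close> gives
      \<open>Suc (M - 1) = M\<close> in spite of truncated subtraction.\<close>
    moreover have "Max (height ` set ?us) > 0"
    proof -
      obtain u where "u \<in> set ?us" using False by (meson last_in_set)
      moreover from this have "height u \<noteq> 0" by (simp add: height_eq_0_iff)
      ultimately show ?thesis using False by (subst Max_gr_iff) blast+
    qed
    ultimately show ?thesis using False by auto
  qed
qed

lemma children_extend_leaves_neq_Nil: "1 \<le> k \<Longrightarrow> children (extend_leaves k t) \<noteq> []"
  by (cases t) auto

lemma delete_extend_leaves: "1 \<le> k \<Longrightarrow> delete_leaves (extend_leaves k t) = t"
proof (induction t)
  case (Node ts)
  then show ?case
    by (auto simp: filter_map comp_def children_extend_leaves_neq_Nil intro!: map_idI)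
qed

text \<open>Deletion undoes extension and lowers the height by one; the extended tree is not a
  single leaf, so no truncation occurs.\<close>

lemma height_extend_leaves: "1 \<le> k \<Longrightarrow> height (extend_leaves k t) = Suc (height t)"
  using height_delete_leaves[of "extend_leaves k t"] children_extend_leaves_neq_Nil[of k t]
    height_eq_0_iff[of "extend_leaves k t"]
  by (simp add: delete_extend_leaves)

text \<open>Below \<open>height T\<close> this is the construction itself; from there on it holds
  because deletion is a left inverse of extension. Thus a single rule links consecutive blocks on
  both sides of \<open>height T\<close>.\<close>

lemma delete_leaves_block:
  assumes "1 \<le> k" "2 \<le> height T" "2 \<le> i"
  shows "delete_leaves (block k T (Suc i)) = block k T i"
proof (cases "i < height T")
  case True
  then show ?thesis using block_below[of i T k] assms by simp
next
  case False
  then show ?thesis using block_above[of T "Suc i" k] assms by (simp add: delete_extend_leaves)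
qed

lemma height_block:
  assumes "1 \<le> k" "2 \<le> height T" "2 \<le> i"
  shows "height (block k T i) = i"
proof (cases "i < height T")
  case True
  have "height ((delete_leaves ^^ n) T) = height T - n" for n
    by (induction n) (auto simp: height_delete_leaves)
  then show ?thesis using True assms by (simp add: block_def)
next
  case False
  have "height ((extend_leaves k ^^ n) T) = height T + n" for n
    using assms by (induction n) (auto simp: height_extend_leaves)
  then show ?thesis using False assms by (simp add: block_def)
qed

lemma kind_of_eq_Inner: "2 \<le> height t \<Longrightarrow> kind_of t = Inner"
proof (rule ccontr)
  assume *: "2 \<le> height t" "kind_of t \<noteq> Inner"
  then have ch: "children t \<noteq> []" by (auto simp flip: height_eq_0_iff)
  then have "\<forall>u \<in> set (children t). height u = 0"
    using * by (auto simp: kind_of_def height_eq_0_iff split: if_splits)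
  then have "height ` set (children t) = {0}" using ch by (cases "children t") auto
  then show False using *(1) ch height_eq[of t] by simp
qed

text \<open>The second block has height 2, so without its leaves it has height 1 and is a star; the
  extra child adds one more leaf to it.\<close>

lemma block_1_eq:
  assumes "1 \<le> k" "2 \<le> height T"
  obtains m where "1 \<le> m" "block k T 1 = Node (replicate (Suc m) (Node []))"
    "delete_leaves (block k T 2) = Node (replicate m (Node []))"
proof -
  let ?t = "delete_leaves (block k T 2)"
  have h: "height ?t = 1" using assms by (simp add: height_delete_leaves height_block)
  then have ne: "children ?t \<noteq> []" by (simp flip: height_eq_0_iff)
  have "u = Node []" if "u \<in> set (children ?t)" for u
  proof -
    have "height u \<le> Max (height ` set (children ?t))" using that by simp
    also have "\<dots> = 0" using h ne height_eq[of ?t] by simp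
    finally show ?thesis by (cases u) (simp split: if_splits)
  qed
  then have "children ?t = replicate (length (children ?t)) (Node [])"
    by (intro replicate_eqI) auto
  then show thesis
    using that[of "length (children ?t)"] ne block_first[of T k] assms
    by (simp add: add_first_child_def Suc_leI)
qed

section \<open>Words in which each node is repeated once per label\<close>

definition expand :: "('a \<Rightarrow> nat) \<Rightarrow> 'a list \<Rightarrow> 'a list" where
  "expand w xs = concat (map (\<lambda>v. replicate (w v) v) xs)"

lemma expand_simps [simp]:
  "expand w [] = []" "expand w (x # xs) = replicate (w x) x @ expand w xs"
  "expand w (xs @ ys) = expand w xs @ expand w ys"
  by (simp_all add: expand_def)

lemma length_expand: "length (expand w xs) = sum_list (map w xs)"
  by (induction xs) auto

lemma set_expand_subset: "set (expand w xs) \<subseteq> set xs"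
  by (induction xs) auto

text \<open>The labels of \<open>v\<close> are the interval just after the labels of all earlier
  entries, and distinctness keeps \<open>v\<close> out of the words before and after its own run.
  Labels start at 1 and list indices at 0, hence \<open>l - 1\<close>.\<close>

lemma expand_nth_eq_iff:
  fixes w :: "'a \<Rightarrow> nat" and xs :: "'a list"
  assumes "distinct xs" "v \<in> set xs"
  defines "a \<equiv> sum_list (map w (takeWhile (\<lambda>u. u \<noteq> v) xs))"
  shows "l \<in> {a + 1..a + w v} \<longleftrightarrow> 1 \<le> l \<and> l \<le> length (expand w xs) \<and> expand w xs ! (l - 1) = v"
proof -
  obtain ys zs where xs: "xs = ys @ v # zs" using assms(2) by (meson split_list)
  then have v: "v \<notin> set ys" "v \<notin> set zs" using assms(1) by auto
  have "takeWhile (\<lambda>u. u \<noteq> v) xs = ys"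
    unfolding xs using v by (subst takeWhile_append2) auto
  then have a: "a = length (expand w ys)" by (simp add: a_def length_expand)
  have ys: "expand w ys ! i \<noteq> v" if "i < length (expand w ys)" for i
    using v(1) set_expand_subset[of w ys] nth_mem[OF that] by blast
  have zs: "expand w zs ! i \<noteq> v" if "i < length (expand w zs)" for i
    using v(2) set_expand_subset[of w zs] nth_mem[OF that] by blast
  show ?thesis
  proof (cases "l = 0 \<or> length (expand w xs) < l")
    case True
    then show ?thesis by (auto simp: a xs)
  next
    case False
    then show ?thesis
      using ys[of "l - 1"] zs[of "l - 1 - a - w v"]
      by (simp add: xs a nth_append) linarith
  qed
qed

lemma card_nth_take:
  assumes "n \<le> length xs"
  shows "card {l. 1 \<le> l \<and> l \<le> n \<and> Q (xs ! (l - 1))} = length (filter Q (take n xs))"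
proof -
  have "{l. 1 \<le> l \<and> l \<le> n \<and> Q (xs ! (l - 1))} = Suc ` {i. i < length (take n xs) \<and> Q (take n xs ! i)}"
  proof (intro set_eqI iffI)
    fix l assume "l \<in> {l. 1 \<le> l \<and> l \<le> n \<and> Q (xs ! (l - 1))}"
    then show "l \<in> Suc ` {i. i < length (take n xs) \<and> Q (take n xs ! i)}"
      using assms by (intro image_eqI[of _ _ "l - 1"]) auto
  qed (use assms in auto)
  then show ?thesis by (simp add: card_image length_filter_conv_card)
qed

section \<open>Balanced words: leaf letters as shifted copies of penultimate letters\<close>

definition balanced :: "nat \<Rightarrow> nat \<Rightarrow> kind list \<Rightarrow> bool" where
  "balanced k j w \<longleftrightarrow>
     (\<forall>n. count_list (take n w) Leaf = (\<Sum>i = 1..k. count_list (take (n - i * j) w) Penult))"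

text \<open>Truncated subtraction is what makes balance compatible with concatenation: a shift
  reaching back before the second word yields an empty prefix of it, and the two subtractions
  commute.\<close>

lemma balanced_append:
  assumes "balanced k j v" "balanced k j w"
  shows "balanced k j (v @ w)"
proof -
  have "n - i * j - length v = n - length v - i * j" for n i by simp
  then show ?thesis using assms by (simp add: balanced_def sum.distrib)
qed

lemma balanced_Nil: "balanced k j []"
  by (simp add: balanced_def)

lemma count_list_filter: "count_list xs a = length (filter (\<lambda>x. x = a) xs)"
  by (induction xs) auto

lemma count_list_replicate: "count_list (replicate n x) y = (if x = y then n else 0)"
  by (induction n) auto

lemma balanced_replicate_Inner: "balanced k j (replicate n Inner)"
  by (simp add: balanced_def count_list_replicate)

text \<open>The word of a penultimate node followed by its \<open>k\<close> leaves: the leaf run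
  splits into \<open>k\<close> runs of length \<open>j\<close>, the \<open>i\<close>-th of which
  starts after \<open>i * j\<close> letters.\<close>

lemma balanced_Penult_Leaf: "balanced k j (replicate j Penult @ replicate (k * j) Leaf)"
proof -
  have "min (n - j) (k * j) = (\<Sum>i = 1..k. min (n - i * j) j)" for n
  proof (induction k)
    case (Suc k)
    have "min (n - j) (Suc k * j) = min (n - j) (k * j) + min (n - Suc k * j) j"
      unfolding mult_Suc by linarith
    then show ?case using Suc by simp
  qed simp
  then show ?thesis by (simp add: balanced_def count_list_replicate)
qed

lemma balanced_concat: "\<forall>w \<in> set ws. balanced k j w \<Longrightarrow> balanced k j (concat ws)"
  by (induction ws) (auto simp: balanced_Nil balanced_append)

abbreviation repeat_each :: "nat \<Rightarrow> 'a list \<Rightarrow> 'a list" where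
  "repeat_each j \<equiv> expand (\<lambda>_. j)"

lemma repeat_each_replicate: "repeat_each j (replicate n a) = replicate (n * j) a"
  by (induction n) (auto simp: replicate_add)

lemma repeat_each_concat: "repeat_each j (concat xss) = concat (map (repeat_each j) xss)"
  by (induction xss) auto

lemma map_repeat_each: "map f (repeat_each j xs) = repeat_each j (map f xs)"
  by (induction xs) auto

lemma filter_repeat_each: "filter P (repeat_each j xs) = repeat_each j (filter P xs)"
  by (induction xs) auto

text \<open>Each old leaf becomes a penultimate node directly followed in pre-order by its
  \<open>k\<close> leaves. Every other old node becomes \<open>Inner\<close>, since all its children
  now have children. So the word is a concatenation of balanced pieces.\<close>

lemma balanced_kinds_extend_leaves:
  assumes "1 \<le> k"
  shows "balanced k j (repeat_each j (kinds (extend_leaves k t)))"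
proof (induction t)
  case (Node ts)
  show ?case
  proof (cases "ts = []")
    case True
    have "concat (map kinds (replicate k (Node []))) = replicate k Leaf"
      by (induction k) (auto simp: kind_of_def)
    moreover have "kind_of (Node (replicate k (Node []))) = Penult"
      using assms by (simp add: kind_of_def)
    ultimately show ?thesis
      using True balanced_Penult_Leaf[of k j] by (simp add: repeat_each_replicate del: map_replicate)
  next
    case False
    then have "kind_of (Node (map (extend_leaves k) ts)) = Inner"
      using children_extend_leaves_neq_Nil[OF assms] by (cases ts) (auto simp: kind_of_def)
    then show ?thesis
      using False Node
      by (auto simp: repeat_each_concat intro!: balanced_append balanced_replicate_Inner balanced_concat)
  qed
qed

text \<open>This later gives every block beyond \<open>height T\<close> at least
  \<open>k * j\<close> labels.\<close>

lemma length_kinds_extend_leaves: "1 \<le> k \<Longrightarrow> k < length (kinds (extend_leaves k t))"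
proof (induction t)
  case (Node ts)
  show ?case
  proof (cases ts)
    case Nil
    have "length (concat (map kinds (replicate k (Node [])))) = k" by (induction k) auto
    then show ?thesis using Nil by simp
  next
    case (Cons t us)
    then show ?thesis using Node.IH[of t] Node.prems by simp
  qed
qed

section \<open>Leaves and penultimate nodes of \<K> in terms of kinds\<close>

locale leaf_counting =
  fixes k j s :: nat and T :: otree
  assumes k_pos: "1 \<le> k" and j_pos: "1 \<le> j" and height_T: "2 \<le> height T"
begin

definition node_kind :: "node \<Rightarrow> kind" where
  "node_kind v = kind_of (subtree (block k T (fst v)) (snd v))"

text \<open>The first supernode is included: there is no earlier supernode, so its children all lie
  in its own block as well.\<close>

lemma child_of_regular:
  assumes "v \<in> nodes k T" "fst v = 1 \<or> snd v \<noteq> []"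
  shows "child_of k T u v \<longleftrightarrow>
    (\<exists>c < length (children (subtree (block k T (fst v)) (snd v))). u = (fst v, snd v @ [c]))"
proof -
  obtain i x i' y where uv: "v = (i, x)" "u = (i', y)" by fastforce
  have "child_of k T u v \<longleftrightarrow> u \<in> nodes k T \<and> i' = i \<and> (\<exists>c. y = x @ [c])"
    using assms by (auto simp: uv child_of_def nodes_def is_supernode_def)
  also have "\<dots> \<longleftrightarrow> i' = i \<and> (\<exists>c < length (children (subtree (block k T i) x)). y = x @ [c])"
  proof -
    have "(i, x @ [c]) \<in> nodes k T \<longleftrightarrow> c < length (children (subtree (block k T i) x))" for c
      using assms(1) by (simp add: uv nodes_def snoc_in_preorder)
    then show ?thesis unfolding uv(2) by blast
  qed
  finally show ?thesis by (auto simp: uv)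
qed

lemma supernode_in_nodes: "1 \<le> i \<Longrightarrow> (i, []) \<in> nodes k T"
  by (simp add: nodes_def Nil_in_preorder)

lemma child_of_supernode: "2 \<le> i \<Longrightarrow> child_of k T (i - 1, []) (i, [])"
  by (simp add: child_of_def supernode_in_nodes is_supernode_def)

lemma node_kind_supernode: "2 \<le> i \<Longrightarrow> node_kind (i, []) = Inner"
  using kind_of_eq_Inner[of "block k T i"] k_pos height_T by (simp add: node_kind_def height_block)

text \<open>The only nodes with a child outside their block are the supernodes from the second on;
  these are not leaves, and their kind is \<open>Inner\<close>.\<close>

lemma is_leaf_iff:
  assumes "v \<in> nodes k T"
  shows "is_leaf k T v \<longleftrightarrow> node_kind v = Leaf"
proof (cases "fst v = 1 \<or> snd v \<noteq> []")
  case True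
  have "is_leaf k T v \<longleftrightarrow> \<not> (\<exists>c. c < length (children (subtree (block k T (fst v)) (snd v))))"
    unfolding is_leaf_def child_of_regular[OF assms True] using assms by blast
  then show ?thesis
    unfolding node_kind_def kind_of_def by (metis (full_types) gr_zeroI kind.distinct(1,3) length_0_conv not_less_zero)
next
  case False
  then obtain i where v: "v = (i, [])" "2 \<le> i" using assms by (cases v) (auto simp: nodes_def)
  have "\<not> is_leaf k T v" unfolding is_leaf_def v(1) using child_of_supernode[OF v(2)] by blast
  then show ?thesis using node_kind_supernode[OF v(2)] v(1) by simp
qed

lemma not_is_leaf_supernode: "1 \<le> i \<Longrightarrow> \<not> is_leaf k T (i, [])"
proof (cases "i = 1")
  case True
  obtain m where "block k T 1 = Node (replicate (Suc m) (Node []))"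
    using block_1_eq k_pos height_T by metis
  then show ?thesis
    using True by (simp add: is_leaf_iff supernode_in_nodes node_kind_def kind_of_def)
qed (use is_leaf_iff supernode_in_nodes node_kind_supernode in auto)

text \<open>From the second supernode on, the preceding supernode is a child that is never a leaf,
  which agrees with the kind \<open>Inner\<close>. All other nodes have their children within the
  block.\<close>

lemma is_penultimate_iff:
  assumes "v \<in> nodes k T"
  shows "is_penultimate k T v \<longleftrightarrow> node_kind v = Penult"
proof (cases "fst v = 1 \<or> snd v \<noteq> []")
  case True
  let ?t = "subtree (block k T (fst v)) (snd v)"
  have nodes: "(fst v, snd v @ [c]) \<in> nodes k T" if "c < length (children ?t)" for c
    using that assms by (auto simp: nodes_def snoc_in_preorder)
  have kind_Leaf: "kind_of t = Leaf \<longleftrightarrow> children t = []" for t by (simp add: kind_of_def)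
  have child: "is_leaf k T (fst v, snd v @ [c]) \<longleftrightarrow> children (children ?t ! c) = []"
    if "c < length (children ?t)" for c
    unfolding is_leaf_iff[OF nodes[OF that]] node_kind_def fst_conv snd_conv subtree_snoc
    by (rule kind_Leaf)
  have self: "is_leaf k T v \<longleftrightarrow> children ?t = []"
    unfolding is_leaf_iff[OF assms] node_kind_def by (rule kind_Leaf)
  have "(\<forall>u. child_of k T u v \<longrightarrow> is_leaf k T u) \<longleftrightarrow>
      (\<forall>c < length (children ?t). is_leaf k T (fst v, snd v @ [c]))"
    unfolding child_of_regular[OF assms True] by blast
  also have "\<dots> \<longleftrightarrow> (\<forall>u \<in> set (children ?t). children u = [])"
    unfolding all_set_conv_all_nth using child by blast
  finally have "is_penultimate k T v \<longleftrightarrow>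
      children ?t \<noteq> [] \<and> (\<forall>u \<in> set (children ?t). children u = [])"
    unfolding is_penultimate_def self using assms by blast
  then show ?thesis unfolding node_kind_def kind_of_def by auto
next
  case False
  then obtain i where v: "v = (i, [])" "2 \<le> i" using assms by (cases v) (auto simp: nodes_def)
  then have "\<not> is_leaf k T (i - 1, [])" by (intro not_is_leaf_supernode) simp
  then have "\<not> is_penultimate k T v"
    using child_of_supernode[OF v(2)] v(1) unfolding is_penultimate_def by blast
  then show ?thesis using node_kind_supernode[OF v(2)] v(1) by simp
qed

section \<open>Labels as positions in a word\<close>

definition trav :: "nat \<Rightarrow> node list" where
  "trav I = traversal_upto k T I"

definition positions :: "nat \<Rightarrow> node list" where
  "positions I = expand (num_labels j s) (trav I)"

text \<open>The infinite word is represented by its prefixes, one for each number of complete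
  blocks; a statement about labels up to \<open>n\<close> uses any \<open>I\<close> with
  \<open>n\<close> at most the length of \<open>word I\<close>.\<close>

definition word :: "nat \<Rightarrow> kind list" where
  "word I = map node_kind (positions I)"

definition block_word :: "nat \<Rightarrow> kind list" where
  "block_word i = map node_kind (expand (num_labels j s) (block_traversal k T i))"

lemma trav_0: "trav 0 = []"
  by (simp add: trav_def traversal_upto_def)

lemma trav_Suc: "trav (Suc I) = trav I @ block_traversal k T (Suc I)"
  by (simp add: trav_def traversal_upto_def)

lemma word_0: "word 0 = []"
  by (simp add: word_def positions_def trav_0)

lemma word_Suc: "word (Suc I) = word I @ block_word (Suc I)"
  by (simp add: word_def positions_def block_word_def trav_Suc)

lemma trav_prefix: "I \<le> I' \<Longrightarrow> \<exists>ys. trav I' = trav I @ ys"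
  by (induction rule: dec_induct) (auto simp: trav_Suc)

lemma word_prefix: "I \<le> I' \<Longrightarrow> \<exists>ys. word I' = word I @ ys"
  by (induction rule: dec_induct) (auto simp: word_Suc)

lemma block_traversal_1:
  obtains m where "1 \<le> m" "block k T 1 = Node (replicate (Suc m) (Node []))"
    "delete_leaves (block k T 2) = Node (replicate m (Node []))"
    "block_traversal k T 1 = map (Pair 1) ([0] # [] # preorder_forest 1 (replicate m (Node [])))"
proof -
  obtain m where m: "1 \<le> m" "block k T 1 = Node (replicate (Suc m) (Node []))"
    "delete_leaves (block k T 2) = Node (replicate m (Node []))"
    using block_1_eq k_pos height_T by metis
  \<comment> \<open>These addresses start with an index of at least 1, so the filter in
    \<open>block_traversal\<close> removes nothing but the extra child.\<close>
  have "filter (\<lambda>x. x \<noteq> [0]) (preorder_forest 1 (replicate m (Node [])))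
      = preorder_forest 1 (replicate m (Node []))"
    by (auto simp: filter_id_conv set_preorder_forest)
  then show thesis using that[OF m] m(2) by (simp add: block_traversal_def)
qed

lemma set_block_traversal:
  assumes "1 \<le> i"
  shows "set (block_traversal k T i) = {v \<in> nodes k T. fst v = i}"
proof -
  have "[0] \<in> set (preorder (block k T 1))"
    using block_traversal_1 by (metis Cons_in_preorder Nil_in_preorder length_replicate otree.sel zero_less_Suc)
  then show ?thesis using assms by (auto simp: block_traversal_def nodes_def)
qed

lemma distinct_block_traversal: "distinct (block_traversal k T i)"
  by (auto simp: block_traversal_def distinct_map inj_on_def distinct_preorder)

lemma set_trav: "set (trav I) = {v \<in> nodes k T. fst v \<le> I}"
proof (induction I)
  case 0
  then show ?case by (auto simp: trav_0 nodes_def)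
next
  case (Suc I)
  have "set (trav (Suc I)) = {v \<in> nodes k T. fst v \<le> I} \<union> {v \<in> nodes k T. fst v = Suc I}"
    by (simp add: trav_Suc set_block_traversal Suc)
  also have "\<dots> = {v \<in> nodes k T. fst v \<le> Suc I}"
    unfolding le_Suc_eq by blast
  finally show ?case .
qed

lemma distinct_trav: "distinct (trav I)"
  by (induction I)
    (auto simp: trav_0 trav_Suc distinct_block_traversal set_trav set_block_traversal)

text \<open>\<open>label_offset\<close> looks only at the blocks up to that of \<open>v\<close>. Any
  larger \<open>I\<close> gives the same offset, because \<open>takeWhile\<close> stops at
  \<open>v\<close>.\<close>

lemma labels_iff:
  assumes "v \<in> nodes k T" "fst v \<le> I"
  shows "l \<in> labels k j s T v \<longleftrightarrow> 1 \<le> l \<and> l \<le> length (positions I) \<and> positions I ! (l - 1) = v"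
proof -
  obtain ys where ys: "trav I = trav (fst v) @ ys" using trav_prefix assms(2) by blast
  have "v \<in> set (trav (fst v))" using assms by (simp add: set_trav)
  then have "takeWhile (\<lambda>u. u \<noteq> v) (trav I) = takeWhile (\<lambda>u. u \<noteq> v) (trav (fst v))"
    unfolding ys by (subst takeWhile_append1) auto
  moreover have "v \<in> set (trav I)" using assms by (simp add: set_trav)
  ultimately show ?thesis
    using expand_nth_eq_iff[OF distinct_trav, of v I l "num_labels j s"]
    by (simp add: labels_def label_offset_def positions_def trav_def)
qed

text \<open>Positions within the first \<open>I\<close> blocks are already occupied by nodes of
  these blocks.\<close>

lemma labels_above:
  assumes "v \<in> nodes k T" "I < fst v" "l \<in> labels k j s T v"
  shows "length (positions I) < l"
proof (rule ccontr)
  assume l: "\<not> length (positions I) < l"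
  obtain ys where ys: "trav (fst v) = trav I @ ys" using trav_prefix assms(2) less_imp_le by blast
  have "1 \<le> l" and "positions (fst v) ! (l - 1) = v" using labels_iff[of v "fst v" l] assms by auto
  moreover from this have "l - 1 < length (positions I)" using l by linarith
  ultimately have "positions I ! (l - 1) = v" by (simp add: positions_def ys nth_append)
  moreover have "positions I ! (l - 1) \<in> set (positions I)" using l \<open>1 \<le> l\<close> by simp
  ultimately have "v \<in> set (trav I)"
    using set_expand_subset unfolding positions_def by (metis subsetD)
  then show False using assms by (simp add: set_trav)
qed

lemma positions_nth_in_nodes:
  assumes "i < length (positions I)"
  shows "positions I ! i \<in> nodes k T" "fst (positions I ! i) \<le> I"
  using nth_mem[OF assms] set_expand_subset[of "num_labels j s" "trav I"]
  by (auto simp: positions_def set_trav)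

lemma labels_upto:
  assumes "n \<le> length (positions I)"
  shows "{l. \<exists>v \<in> nodes k T. Q v \<and> l \<in> labels k j s T v \<and> l \<le> n}
    = {l. 1 \<le> l \<and> l \<le> n \<and> Q (positions I ! (l - 1))}"
proof (intro set_eqI iffI; unfold mem_Collect_eq)
  fix l assume "\<exists>v \<in> nodes k T. Q v \<and> l \<in> labels k j s T v \<and> l \<le> n"
  then obtain v where v: "v \<in> nodes k T" "Q v" "l \<in> labels k j s T v" "l \<le> n" by blast
  then have "fst v \<le> I" using labels_above[of v I l] assms by force
  then show "1 \<le> l \<and> l \<le> n \<and> Q (positions I ! (l - 1))" using labels_iff[of v I l] v by auto
next
  fix l assume l: "1 \<le> l \<and> l \<le> n \<and> Q (positions I ! (l - 1))"
  then have "positions I ! (l - 1) \<in> nodes k T" "fst (positions I ! (l - 1)) \<le> I"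
    using positions_nth_in_nodes[of "l - 1" I] assms by auto
  moreover from this have "l \<in> labels k j s T (positions I ! (l - 1))"
    using l assms labels_iff[of "positions I ! (l - 1)" I l] by simp
  ultimately show "\<exists>v \<in> nodes k T. Q v \<and> l \<in> labels k j s T v \<and> l \<le> n"
    using l by blast
qed

lemma length_positions: "length (positions I) = length (word I)"
  by (simp add: word_def)

lemma card_labels_upto:
  assumes "n \<le> length (word I)" "\<And>v. v \<in> nodes k T \<Longrightarrow> Q v \<longleftrightarrow> node_kind v = a"
  shows "card {l. \<exists>v \<in> nodes k T. Q v \<and> l \<in> labels k j s T v \<and> l \<le> n} = count_list (take n (word I)) a"
proof -
  have "card {l. \<exists>v \<in> nodes k T. Q v \<and> l \<in> labels k j s T v \<and> l \<le> n}
      = card {l. \<exists>v \<in> nodes k T. node_kind v = a \<and> l \<in> labels k j s T v \<and> l \<le> n}"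
    by (intro arg_cong[of _ _ card] Collect_cong bex_cong) (use assms in auto)
  also have "\<dots> = length (filter (\<lambda>v. node_kind v = a) (take n (positions I)))"
    using assms(1) labels_upto[of n I "\<lambda>v. node_kind v = a"]
      card_nth_take[of n "positions I" "\<lambda>v. node_kind v = a"]
    by (simp add: length_positions)
  also have "\<dots> = count_list (take n (word I)) a"
    by (simp add: word_def take_map count_list_filter filter_map comp_def)
  finally show ?thesis .
qed

lemma leaf_count_eq:
  assumes "n \<le> length (word I)"
  shows "leaf_count k j s T (int n) = int (count_list (take n (word I)) Leaf)"
proof -
  have "{l \<in> leaf_labels k j s T. int l \<le> int n}
      = {l. \<exists>v \<in> nodes k T. is_leaf k T v \<and> l \<in> labels k j s T v \<and> l \<le> n}"
    by (auto simp: leaf_labels_def is_leaf_def)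
  then show ?thesis
    using card_labels_upto[OF assms, of "is_leaf k T" Leaf] is_leaf_iff by (simp add: leaf_count_def)
qed

lemma Union_block_labels: "(\<Union>i \<in> {1..I}. block_labels k j s T i) = {1..length (word I)}"
proof -
  have "l \<in> (\<Union>i \<in> {1..I}. block_labels k j s T i) \<longleftrightarrow> l \<in> {1..length (word I)}" for l
  proof -
    have "l \<in> (\<Union>i \<in> {1..I}. block_labels k j s T i) \<longleftrightarrow>
        (\<exists>v \<in> nodes k T. fst v \<le> I \<and> l \<in> labels k j s T v)"
    proof -
      have "v \<in> nodes k T \<Longrightarrow> 1 \<le> fst v" for v by (auto simp: nodes_def)
      then show ?thesis unfolding block_labels_def by fastforce
    qed
    also have "\<dots> \<longleftrightarrow> l \<in> {1..length (word I)}"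
    proof
      assume "\<exists>v \<in> nodes k T. fst v \<le> I \<and> l \<in> labels k j s T v"
      then show "l \<in> {1..length (word I)}"
        using labels_iff[of _ I l] unfolding length_positions atLeastAtMost_iff by blast
    next
      assume l: "l \<in> {1..length (word I)}"
      then have "l - 1 < length (positions I)" by (auto simp: length_positions)
      then have "positions I ! (l - 1) \<in> nodes k T" "fst (positions I ! (l - 1)) \<le> I"
        by (rule positions_nth_in_nodes)+
      moreover from this have "l \<in> labels k j s T (positions I ! (l - 1))"
        using l labels_iff[of "positions I ! (l - 1)" I l] by (simp add: length_positions)
      ultimately show "\<exists>v \<in> nodes k T. fst v \<le> I \<and> l \<in> labels k j s T v" by blast
    qed
    finally show ?thesis .
  qed
  then show ?thesis by blast
qed

lemma one_le_label: "l \<in> labels k j s T v \<Longrightarrow> 1 \<le> l"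
  by (simp add: labels_def)

lemma alpha_eq: "alpha k j s T = count_list (word (height T)) Leaf"
proof -
  have "leaf_labels k j s T \<inter> (\<Union>i \<in> {1..height T}. block_labels k j s T i)
      = {l. \<exists>v \<in> nodes k T. is_leaf k T v \<and> l \<in> labels k j s T v \<and> l \<le> length (word (height T))}"
    unfolding Union_block_labels leaf_labels_def is_leaf_def
    using one_le_label by (auto 0 3)
  then show ?thesis
    using card_labels_upto[of "length (word (height T))" "height T" "is_leaf k T" Leaf] is_leaf_iff
    by (simp add: alpha_def)
qed

lemma beta_eq: "beta k j s T = count_list (word (height T)) Penult"
proof -
  have "penultimate_labels k j s T \<inter> (\<Union>i \<in> {1..height T}. block_labels k j s T i)
      = {l. \<exists>v \<in> nodes k T. is_penultimate k T v \<and> l \<in> labels k j s T v \<and> l \<le> length (word (height T))}"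
    unfolding Union_block_labels penultimate_labels_def is_penultimate_def
    using one_le_label by (auto 0 3)
  then show ?thesis
    using card_labels_upto[of "length (word (height T))" "height T" "is_penultimate k T" Penult]
      is_penultimate_iff
    by (simp add: beta_def)
qed

text \<open>A nonempty block word ensures that the last letter of \<open>word (Suc I)\<close>
  belongs to block \<open>Suc I\<close> and not to an earlier block.\<close>

lemma max_label_eq:
  assumes "block_word (Suc I) \<noteq> []"
  shows "max_label k j s T (Suc I) = length (word (Suc I))"
  unfolding max_label_def
proof (rule Max_eqI)
  let ?n = "length (word (Suc I))"
  have sub: "block_labels k j s T (Suc I) \<subseteq> {1..?n}"
    using Union_block_labels[of "Suc I"] by fastforce
  then show "finite (block_labels k j s T (Suc I))" by (rule finite_subset) simp
  show "l \<le> ?n" if "l \<in> block_labels k j s T (Suc I)" for l using sub that by auto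
  let ?v = "positions (Suc I) ! (?n - 1)"
  have n: "?n - 1 < length (positions (Suc I))" "1 \<le> ?n"
    using assms by (auto simp: length_positions word_Suc Suc_le_eq)
  have "?v \<in> nodes k T" "fst ?v \<le> Suc I" using positions_nth_in_nodes[OF n(1)] by auto
  then have l: "?n \<in> labels k j s T ?v" using n labels_iff[of ?v "Suc I" ?n] by (simp add: length_positions)
  moreover have "\<not> fst ?v \<le> I"
    using l labels_iff[of ?v I ?n] \<open>?v \<in> nodes k T\<close> assms by (auto simp: length_positions word_Suc)
  then have "fst ?v = Suc I" using \<open>fst ?v \<le> Suc I\<close> by simp
  ultimately show "?n \<in> block_labels k j s T (Suc I)"
    using \<open>?v \<in> nodes k T\<close> unfolding block_labels_def by blast
qed

section \<open>Block words and their pruning\<close>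

lemma expand_regular:
  assumes "[] \<notin> set xs"
  shows "map node_kind (expand (num_labels j s) (map (Pair i) xs))
    = repeat_each j (map (\<lambda>x. kind_of (subtree (block k T i) x)) xs)"
  using assms by (induction xs) (auto simp: num_labels_def is_supernode_def node_kind_def)

text \<open>The three runs come from the extra child, the first supernode and its remaining
  children. The number \<open>m\<close> is tied to the pruned second block so that the two can be
  compared later.\<close>

lemma block_word_1:
  obtains m where "delete_leaves (block k T 2) = Node (replicate m (Node []))"
    "block_word 1 = replicate j Leaf @ replicate s Penult @ replicate (m * j) Leaf"
proof -
  obtain m where m: "1 \<le> m" "block k T 1 = Node (replicate (Suc m) (Node []))"
    "delete_leaves (block k T 2) = Node (replicate m (Node []))"
    "block_traversal k T 1 = map (Pair 1) ([0] # [] # preorder_forest 1 (replicate m (Node [])))"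
    by (rule block_traversal_1)
  have "[] \<notin> set (preorder_forest 1 (replicate m (Node [])))" by (simp add: set_preorder_forest)
  note * = expand_regular[OF this, of 1]
  have "map (\<lambda>x. kind_of (subtree (block k T 1) x)) (preorder_forest 1 (replicate m (Node [])))
      = concat (map kinds (replicate m (Node [])))"
    unfolding m(2) by (intro map_kind_preorder_forest) simp
  also have "\<dots> = replicate m Leaf" by (induction m) (auto simp: kind_of_def)
  finally have "map node_kind (expand (num_labels j s) (map (Pair 1) (preorder_forest 1 (replicate m (Node [])))))
      = replicate (m * j) Leaf"
    using * by (simp add: repeat_each_replicate)
  moreover have "node_kind (1, [0]) = Leaf" "node_kind (1, []) = Penult"
    unfolding node_kind_def fst_conv snd_conv m(2) by (simp_all add: kind_of_def)
  ultimately have "block_word 1 = replicate j Leaf @ replicate s Penult @ replicate (m * j) Leaf"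
    unfolding block_word_def m(4) by (simp add: num_labels_def is_supernode_def)
  then show thesis using that m(3) by blast
qed

lemma block_word_ge_2:
  assumes "2 \<le> i"
  shows "block_word i = replicate s Inner @ repeat_each j (concat (map kinds (children (block k T i))))"
proof -
  obtain ts where ts: "block k T i = Node ts" by (cases "block k T i")
  have "[] \<notin> set (preorder_forest 0 ts)" by (simp add: set_preorder_forest)
  note expand_regular[OF this, of i]
  moreover have "map (\<lambda>x. kind_of (subtree (block k T i) x)) (preorder_forest 0 ts) = concat (map kinds ts)"
    unfolding ts by (intro map_kind_preorder_forest) simp
  ultimately show ?thesis
    using assms node_kind_supernode[OF assms]
    by (simp add: block_word_def block_traversal_def ts num_labels_def is_supernode_def map_replicate)
qed

text \<open>The root is cut off because a supernode carries \<open>s\<close> labels instead of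
  \<open>j\<close>. Being \<open>Inner\<close>, it contributes one \<open>False\<close> to either
  side.\<close>

lemma forest_kinds_delete_leaves:
  assumes "2 \<le> height t"
  shows "map (\<lambda>a. a = Leaf) (concat (map kinds (children (delete_leaves t))))
    = map (\<lambda>a. a = Penult) (filter (\<lambda>a. a \<noteq> Leaf) (concat (map kinds (children t))))"
proof -
  have "children t \<noteq> []" using assms by (auto simp: height_eq_0_iff[symmetric])
  from kinds_delete_leaves[OF this] kind_of_eq_Inner[OF assms] show ?thesis
    by (cases t) simp
qed

lemma prune_block_word:
  assumes "2 \<le> i"
  shows "map (\<lambda>a. a = Penult) (filter (\<lambda>a. a \<noteq> Leaf) (block_word (Suc i)))
    = map (\<lambda>a. a = Leaf) (block_word i)"
  using assms forest_kinds_delete_leaves[of "block k T (Suc i)"] k_pos height_T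
  by (simp add: block_word_ge_2 height_block delete_leaves_block map_repeat_each filter_repeat_each)

text \<open>Here \<open>v\<close> is the first block without its extra child, which is what remains
  of the second block after pruning.\<close>

lemma prune_block_word_2:
  assumes "block_word 1 = replicate j Leaf @ v"
  shows "map (\<lambda>a. a = Penult) (filter (\<lambda>a. a \<noteq> Leaf) (block_word 2)) = map (\<lambda>a. a = Leaf) v"
proof -
  obtain m where m: "delete_leaves (block k T 2) = Node (replicate m (Node []))"
    "block_word 1 = replicate j Leaf @ replicate s Penult @ replicate (m * j) Leaf"
    by (rule block_word_1)
  have "concat (map kinds (replicate m (Node []))) = replicate m Leaf"
    by (induction m) (auto simp: kind_of_def)
  then have "map (\<lambda>a. a = Penult) (filter (\<lambda>a. a \<noteq> Leaf) (concat (map kinds (children (block k T 2)))))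
      = replicate m True"
    using forest_kinds_delete_leaves[of "block k T 2"] k_pos height_T m(1)
    by (simp add: height_block del: map_replicate) simp
  moreover have "v = replicate s Penult @ replicate (m * j) Leaf" using m(2) assms by simp
  ultimately show ?thesis
    by (simp add: block_word_ge_2 map_repeat_each filter_repeat_each repeat_each_replicate)
qed

text \<open>Pruning turns block \<open>i + 1\<close> into block \<open>i\<close>, without the extra
  child if \<open>i = 1\<close>. What survives of the first block is its supernode, matching the
  extra child; as these carry \<open>s\<close> and \<open>j\<close> labels, both runs are split off
  before comparing.\<close>

lemma prune_word:
  assumes "1 \<le> I"
  obtains v u where "word (Suc I) = replicate j Leaf @ replicate s Penult @ v"
    "word I = replicate j Leaf @ u"
    "map (\<lambda>a. a = Penult) (filter (\<lambda>a. a \<noteq> Leaf) v) = map (\<lambda>a. a = Leaf) u"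
proof -
  have "\<exists>v u. word (Suc I) = replicate j Leaf @ replicate s Penult @ v
    \<and> word I = replicate j Leaf @ u
    \<and> map (\<lambda>a. a = Penult) (filter (\<lambda>a. a \<noteq> Leaf) v) = map (\<lambda>a. a = Leaf) u"
    using assms
  proof (induction I rule: dec_induct)
    case base
    obtain m where m: "block_word 1 = replicate j Leaf @ replicate s Penult @ replicate (m * j) Leaf"
      by (rule block_word_1)
    let ?u = "replicate s Penult @ replicate (m * j) Leaf"
    \<comment> \<open>The remaining leaves of the first block vanish under pruning, so only the
      second block has to match \<open>?u\<close>.\<close>
    show ?case
      using prune_block_word_2[OF m] m
      by (intro exI[of _ "replicate (m * j) Leaf @ block_word 2"] exI[of _ ?u])
        (simp add: word_Suc word_0 numeral_2_eq_2)
  next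
    case (step I)
    then obtain v u where vu: "word (Suc I) = replicate j Leaf @ replicate s Penult @ v"
      "word I = replicate j Leaf @ u"
      "map (\<lambda>a. a = Penult) (filter (\<lambda>a. a \<noteq> Leaf) v) = map (\<lambda>a. a = Leaf) u"
      by blast
    have "word (Suc (Suc I)) = replicate j Leaf @ replicate s Penult @ v @ block_word (Suc (Suc I))"
      using vu(1) word_Suc[of "Suc I"] by simp
    moreover have "word (Suc I) = replicate j Leaf @ u @ block_word (Suc I)"
      using vu(2) word_Suc[of I] by simp
    moreover have "map (\<lambda>a. a = Penult) (filter (\<lambda>a. a \<noteq> Leaf) (v @ block_word (Suc (Suc I))))
        = map (\<lambda>a. a = Leaf) (u @ block_word (Suc I))"
      using vu(3) prune_block_word[of "Suc I"] step.hyps by simp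
    ultimately show ?case by blast
  qed
  then show thesis using that by blast
qed

section \<open>Blocks beyond the height of T\<close>

lemma block_word_above:
  assumes "height T < i"
  shows "balanced k j (block_word i)" "k * j \<le> length (block_word i)"
proof -
  have i: "2 \<le> i" using assms height_T by simp
  let ?t = "block k T (i - 1)"
  have "height ?t \<noteq> 0" using height_block[of k T "i - 1"] assms height_T k_pos by simp
  then have "children ?t \<noteq> []" by (simp add: height_eq_0_iff)
  then obtain ts where ts: "?t = Node ts" "ts \<noteq> []" by (cases ?t) auto
  then have ch: "children (block k T i) = map (extend_leaves k) ts"
    using block_above[OF height_T assms] by simp
  show "balanced k j (block_word i)"
    unfolding block_word_ge_2[OF i] ch
    using balanced_kinds_extend_leaves[OF k_pos]
    by (auto simp: repeat_each_concat intro!: balanced_append balanced_replicate_Inner balanced_concat)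
  obtain t us where "ts = t # us" using ts(2) by (cases ts) auto
  then have "k \<le> length (concat (map kinds (map (extend_leaves k) ts)))"
    using length_kinds_extend_leaves[OF k_pos, of t] by simp
  then have "k * j \<le> length (concat (map kinds (map (extend_leaves k) ts))) * j"
    by (rule mult_right_mono) simp
  moreover have "length (block_word i) = s + length (concat (map kinds (map (extend_leaves k) ts))) * j"
    unfolding block_word_ge_2[OF i] ch by (simp add: length_expand sum_list_triv)
  ultimately show "k * j \<le> length (block_word i)" by linarith
qed

text \<open>Splitting off the first \<open>height T\<close> blocks isolates the counts
  \<open>alpha\<close> and \<open>beta\<close>; what follows is a concatenation of balanced
  blocks.\<close>

lemma word_above:
  assumes "height T \<le> I"
  obtains w where "word I = word (height T) @ w" "balanced k j w"
proof -
  have "\<exists>w. word I = word (height T) @ w \<and> balanced k j w"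
    using assms
  proof (induction I rule: dec_induct)
    case base
    then show ?case by (simp add: balanced_Nil)
  next
    case (step I)
    then obtain w where "word I = word (height T) @ w" "balanced k j w" by blast
    then show ?case
      using block_word_above(1)[of "Suc I"] step.hyps
      by (intro exI[of _ "w @ block_word (Suc I)"]) (simp add: word_Suc balanced_append)
  qed
  then show thesis using that by blast
qed

text \<open>Each block beyond \<open>height T\<close> has at least one label, so every
  \<open>n\<close> is covered by some finite word.\<close>

lemma word_length_ge: "I \<le> length (word (height T + I))"
proof (induction I)
  case (Suc I)
  have "1 * 1 \<le> k * j" using k_pos j_pos by (intro mult_le_mono)
  then have "1 \<le> length (block_word (Suc (height T + I)))"
    using block_word_above(2)[of "Suc (height T + I)"] by linarith
  then show ?case using Suc by (simp add: word_Suc)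
qed simp

section \<open>The recurrence and its unique solution\<close>

definition R :: "int \<Rightarrow> int" where
  "R = leaf_count k j s T"

lemma length_word_height: "j + s \<le> length (word (height T))"
proof -
  obtain ys where "word (height T) = word 1 @ ys" using word_prefix[of 1 "height T"] height_T by auto
  moreover obtain m where "block_word 1 = replicate j Leaf @ replicate s Penult @ replicate (m * j) Leaf"
    by (rule block_word_1)
  ultimately show ?thesis by (simp add: word_Suc word_0)
qed

text \<open>Pruning the first \<open>m\<close> letters leaves the \<open>s\<close> letters of the
  first supernode and \<open>q\<close> further ones. Trading those \<open>s\<close> letters for the
  \<open>j\<close> of the extra child gives a prefix of \<open>word I\<close> of length
  \<open>j + q\<close>, which is \<open>m'\<close>; its leaf letters are \<open>j\<close> from the
  extra child and one for each penultimate letter after the first supernode.\<close>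

lemma R_prune:
  assumes "1 \<le> I" "j + s \<le> m" "m \<le> length (word (Suc I))"
  obtains m' where "int m' = int m - R (int m) + int j - int s" "j \<le> m'" "m' \<le> m"
    "R (int m') = int (count_list (take m (word (Suc I))) Penult) + int j - int s"
proof -
  obtain v u where w: "word (Suc I) = replicate j Leaf @ replicate s Penult @ v"
    "word I = replicate j Leaf @ u"
    "map (\<lambda>a. a = Penult) (filter (\<lambda>a. a \<noteq> Leaf) v) = map (\<lambda>a. a = Leaf) u"
    using prune_word[OF assms(1)] by blast
  let ?v = "take (m - j - s) v"
  have take_w: "take m (word (Suc I)) = replicate j Leaf @ replicate s Penult @ ?v"
  proof -
    have "min m j = j" "min (m - j) s = s" using assms(2) by linarith+
    then show ?thesis by (simp add: w(1))
  qed
  define q where "q = length (filter (\<lambda>a. a \<noteq> Leaf) ?v)"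
  have split: "filter (\<lambda>a. a \<noteq> Leaf) v
      = filter (\<lambda>a. a \<noteq> Leaf) ?v @ filter (\<lambda>a. a \<noteq> Leaf) (drop (m - j - s) v)"
    by (metis append_take_drop_id filter_append)
  \<comment> \<open>Pruning a prefix of \<open>v\<close> yields a prefix of the pruned
    \<open>v\<close>, and \<open>q\<close> is its length.\<close>
  then have take_q: "take q (filter (\<lambda>a. a \<noteq> Leaf) v) = filter (\<lambda>a. a \<noteq> Leaf) ?v"
    by (simp add: q_def)
  have len_v: "length ?v = m - j - s" using assms by (simp add: w(1))
  have "count_list ?v Leaf + q = length ?v"
    unfolding q_def count_list_filter by (rule sum_length_filter_compl)
  \<comment> \<open>Together with \<open>Rm\<close> this shows that \<open>j + q\<close> is the
    required value of \<open>m'\<close>.\<close>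
  then have q: "q + count_list ?v Leaf + j + s = m" using len_v assms(2) by simp
  have Rm: "R (int m) = int (j + count_list ?v Leaf)"
    using leaf_count_eq[OF assms(3)] by (simp add: R_def take_w count_list_replicate)
  have "length u = length (filter (\<lambda>a. a \<noteq> Leaf) v)" using w(3) by (metis length_map)
  then have q_le: "q \<le> length u" using split by (simp add: q_def)
  have "count_list (take q u) Leaf = count_list (take q (map (\<lambda>a. a = Leaf) u)) True"
    by (simp add: take_map count_list_filter filter_map comp_def)
  also have "\<dots> = count_list (map (\<lambda>a. a = Penult) (filter (\<lambda>a. a \<noteq> Leaf) ?v)) True"
    by (simp add: w(3)[symmetric] take_map take_q)
  also have "\<dots> = length (filter (\<lambda>a. a \<noteq> Leaf \<and> a = Penult) ?v)"
    by (simp add: count_list_filter filter_map comp_def)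
  also have "\<dots> = count_list ?v Penult"
    unfolding count_list_filter by (rule arg_cong[of _ _ length], rule filter_cong) auto
  finally have "count_list (take q u) Leaf = count_list ?v Penult" .
  then have "R (int (j + q)) = int (j + count_list ?v Penult)"
    using leaf_count_eq[of "j + q" I] q_le by (simp add: R_def w(2) count_list_replicate)
  then show thesis
    using q Rm by (intro that[of "j + q"]) (auto simp: take_w count_list_replicate)
qed

lemma max_label_Suc_height:
  "max_label k j s T (Suc (height T)) = length (word (Suc (height T)))"
proof -
  have "block_word (Suc (height T)) \<noteq> []"
    using block_word_above(2)[of "Suc (height T)"] k_pos j_pos by auto
  then show ?thesis by (rule max_label_eq)
qed

text \<open>The source of the threshold: for \<open>n\<close> beyond block
  \<open>height T + 1\<close>, each \<open>n - i * j\<close> with \<open>i \<le> k\<close> is still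
  no smaller than the number of labels in the first \<open>height T\<close> blocks.\<close>

lemma max_label_ge: "length (word (height T)) + k * j \<le> max_label k j s T (Suc (height T))"
  using block_word_above(2)[of "Suc (height T)"] by (simp add: max_label_Suc_height word_Suc)

text \<open>The choice of \<open>I\<close> depends on \<open>n\<close> but not on \<open>i\<close>,
  so one word serves all summands.\<close>

lemma shifted_argument:
  assumes "int (max_label k j s T (Suc (height T))) < n" "i \<in> {1..k}"
  obtains m I where "int m = n - int i * int j" "length (word (height T)) \<le> m"
    "m \<le> length (word (Suc I))" "height T \<le> I" "I = height T + nat n"
proof -
  have "i * j \<le> k * j" using assms(2) by simp
  then have *: "length (word (height T)) + i * j \<le> nat n" using assms(1) max_label_ge by linarith
  have "nat n \<le> length (word (Suc (height T + nat n)))"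
    using word_length_ge[of "Suc (nat n)"] by simp
  then show thesis
    using * that[of "nat n - i * j" "height T + nat n"] assms(1) by (simp add: of_nat_diff)
qed

lemma R_recurrence:
  assumes n: "int (max_label k j s T (Suc (height T))) < n"
  shows "R n = (\<Sum>i = 1..k. R (n - int s - (int i - 1) * int j - R (n - int i * int j))) + nu k j s T"
proof -
  define I where "I = height T + nat n"
  define b where "b = length (word (height T))"
  obtain w where w: "word (Suc I) = word (height T) @ w" "balanced k j w"
    using word_above[of "Suc I"] by (auto simp: I_def)
  \<comment> \<open>The outer argument is \<open>m - R m + j - s\<close> with
    \<open>m = n - i * j\<close>, so \<open>R_prune\<close> applies. The penultimate letters among
    the first \<open>m\<close> are the \<open>beta\<close> ones of the first \<open>height T\<close>
    blocks and those in a prefix of \<open>w\<close>.\<close>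
  have "R (n - int s - (int i - 1) * int j - R (n - int i * int j))
      = int (count_list (take (nat n - b - i * j) w) Penult) + (int (beta k j s T) - int s + int j)"
    if i: "i \<in> {1..k}" for i
  proof -
    obtain m where m: "int m = n - int i * int j" "b \<le> m" "m \<le> length (word (Suc I))"
      using shifted_argument[OF n i] unfolding I_def b_def by metis
    have "1 \<le> I" "j + s \<le> m" using height_T length_word_height m(2) by (auto simp: I_def b_def)
    then obtain m' where m': "int m' = int m - R (int m) + int j - int s"
      "R (int m') = int (count_list (take m (word (Suc I))) Penult) + int j - int s"
      using R_prune m(3) by metis
    have "m = nat n - i * j" using m(1) n by (simp add: nat_diff_distrib' nat_mult_distrib flip: of_nat_mult)
    then have "m - b = nat n - b - i * j" by simp
    moreover have "n - int s - (int i - 1) * int j - R (n - int i * int j) = int m'"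
      unfolding m(1)[symmetric] using m(1) m'(1) by (simp add: algebra_simps)
    ultimately show ?thesis
      using m'(2) m(2) by (simp add: w(1) beta_eq b_def)
  qed
  then have "(\<Sum>i = 1..k. R (n - int s - (int i - 1) * int j - R (n - int i * int j)))
      = int (\<Sum>i = 1..k. count_list (take (nat n - b - i * j) w) Penult)
        + int k * (int (beta k j s T) - int s + int j)"
    by (simp add: sum.distrib)
  \<comment> \<open>Balance of \<open>w\<close>, applied to its prefix of length
    \<open>nat n - b\<close>, collects the shifted penultimate counts into a leaf count.\<close>
  also have "\<dots> = int (count_list (take (nat n - b) w) Leaf) + int k * (int (beta k j s T) - int s + int j)"
    using w(2) by (simp add: balanced_def)
  finally have *: "(\<Sum>i = 1..k. R (n - int s - (int i - 1) * int j - R (n - int i * int j)))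
      = int (count_list (take (nat n - b) w) Leaf) + int k * (int (beta k j s T) - int s + int j)" .
  have "nat n \<le> length (word (Suc I))" using word_length_ge[of "Suc (nat n)"] by (simp add: I_def)
  moreover have "b \<le> nat n" using max_label_ge n by (simp add: b_def)
  ultimately have "R n = int (alpha k j s T) + int (count_list (take (nat n - b) w) Leaf)"
    using leaf_count_eq[of "nat n" "Suc I"] n by (simp add: R_def w(1) alpha_eq b_def)
  then show ?thesis using * by (simp add: nu_def)
qed

text \<open>Inner and outer arguments lie strictly between 0 and \<open>n\<close>, as strong
  induction requires. The outer one is the \<open>m'\<close> of \<open>R_prune\<close>, which lies
  between \<open>j\<close> and \<open>n - i * j\<close>.\<close>

lemma argument_bounds:
  assumes n: "int (max_label k j s T (Suc (height T))) < n" and i: "i \<in> {1..k}"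
  shows "1 \<le> n - int i * int j" "n - int i * int j < n"
    "1 \<le> n - int s - (int i - 1) * int j - R (n - int i * int j)"
    "n - int s - (int i - 1) * int j - R (n - int i * int j) < n"
proof -
  obtain m I where m: "int m = n - int i * int j" "length (word (height T)) \<le> m"
    "m \<le> length (word (Suc I))" "height T \<le> I"
    using shifted_argument[OF n i] by metis
  have ij: "0 < int i * int j" using i j_pos by simp
  have "1 \<le> I" "j + s \<le> m" using height_T length_word_height m by auto
  then obtain m' where m': "int m' = int m - R (int m) + int j - int s" "j \<le> m'" "m' \<le> m"
    using R_prune m(3) by metis
  have eq: "n - int s - (int i - 1) * int j - R (n - int i * int j) = int m'"
    unfolding m(1)[symmetric] using m(1) m'(1) by (simp add: algebra_simps)
  show "1 \<le> n - int i * int j" "n - int i * int j < n"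
    using m(1) \<open>j + s \<le> m\<close> j_pos ij by auto
  show "1 \<le> n - int s - (int i - 1) * int j - R (n - int i * int j)"
    "n - int s - (int i - 1) * int j - R (n - int i * int j) < n"
    unfolding eq using m(1) m' j_pos ij by auto
qed

lemma R_unique:
  assumes rec: "\<And>n. int (max_label k j s T (Suc (height T))) < n \<Longrightarrow>
      L n = (\<Sum>i = 1..k. L (n - int s - (int i - 1) * int j - L (n - int i * int j))) + nu k j s T"
    and init: "\<And>n. 1 \<le> n \<Longrightarrow> n \<le> int (max_label k j s T (Suc (height T))) \<Longrightarrow> L n = R n"
  shows "1 \<le> n \<Longrightarrow> L n = R n"
proof (induction "nat n" arbitrary: n rule: less_induct)
  case less
  show ?case
  proof (cases "int (max_label k j s T (Suc (height T))) < n")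
    case True
    have IH: "L m = R m" if "1 \<le> m" "m < n" for m using less.hyps[of m] that by simp
    have "(\<Sum>i = 1..k. L (n - int s - (int i - 1) * int j - L (n - int i * int j)))
        = (\<Sum>i = 1..k. R (n - int s - (int i - 1) * int j - R (n - int i * int j)))"
      \<comment> \<open>Agreement at the inner argument makes the outer arguments for
        \<open>L\<close> and \<open>R\<close> equal; then the induction hypothesis applies to the
        outer one.\<close>
      by (intro sum.cong refl) (use argument_bounds[OF True] IH in simp)
    then show ?thesis using rec[OF True] R_recurrence[OF True] by simp
  next
    case False
    then show ?thesis using init less.prems by simp
  qed
qed

end

theorem theorem1:
  fixes k j s p :: nat and T :: otree
    and R :: "int \<Rightarrow> int" and N :: "nat \<Rightarrow> int" and \<nu> :: int
  assumes "k \<ge> 1" and "j \<ge> 1" and "height T = p" and "p \<ge> 2"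
  defines "R \<equiv> leaf_count k j s T"
    and "N \<equiv> \<lambda>i. int (max_label k j s T i)"
    and "\<nu> \<equiv> nu k j s T"
  shows "(\<forall>n. n > N (p + 1) \<longrightarrow>
            R n = (\<Sum>i = 1..k. R (n - int s - (int i - 1) * int j - R (n - int i * int j))) + \<nu>)
       \<and> (\<forall>L :: int \<Rightarrow> int.
            (\<forall>n. n > N (p + 1) \<longrightarrow>
               L n = (\<Sum>i = 1..k. L (n - int s - (int i - 1) * int j - L (n - int i * int j))) + \<nu>)
            \<longrightarrow> (\<forall>n. 1 \<le> n \<and> n \<le> N (p + 1) \<longrightarrow> L n = R n)
            \<longrightarrow> (\<forall>n \<ge> 1. L n = R n))"
proof -
  interpret K: leaf_counting k j s T using assms(1-4) by unfold_locales auto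
  have R: "R = K.R" and N: "N (p + 1) = int (max_label k j s T (Suc (height T)))"
    using assms(3) by (simp_all add: R_def N_def K.R_def)
  show ?thesis
    unfolding R N \<nu>_def
  proof (rule conjI)
    show "\<forall>n > int (max_label k j s T (Suc (height T))).
        K.R n = (\<Sum>i = 1..k. K.R (n - int s - (int i - 1) * int j - K.R (n - int i * int j)))
          + nu k j s T"
      using K.R_recurrence by blast
  next
    show "\<forall>L. (\<forall>n > int (max_label k j s T (Suc (height T))).
          L n = (\<Sum>i = 1..k. L (n - int s - (int i - 1) * int j - L (n - int i * int j))) + nu k j s T)
        \<longrightarrow> (\<forall>n. 1 \<le> n \<and> n \<le> int (max_label k j s T (Suc (height T))) \<longrightarrow> L n = K.R n)
        \<longrightarrow> (\<forall>n \<ge> 1. L n = K.R n)"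
    proof (intro allI impI)
      fix L :: "int \<Rightarrow> int" and n :: int
      assume rec: "\<forall>n > int (max_label k j s T (Suc (height T))).
          L n = (\<Sum>i = 1..k. L (n - int s - (int i - 1) * int j - L (n - int i * int j))) + nu k j s T"
        and init: "\<forall>n. 1 \<le> n \<and> n \<le> int (max_label k j s T (Suc (height T))) \<longrightarrow> L n = K.R n"
        and "1 \<le> n"
      show "L n = K.R n"
      proof (rule K.R_unique[OF _ _ \<open>1 \<le> n\<close>])
        show "L m = (\<Sum>i = 1..k. L (m - int s - (int i - 1) * int j - L (m - int i * int j))) + nu k j s T"
          if "int (max_label k j s T (Suc (height T))) < m" for m
          using rec that by blast
        show "L m = K.R m" if "1 \<le> m" "m \<le> int (max_label k j s T (Suc (height T)))" for m
          using init that by blast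
      qed
    qed
  qed
qed

end
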